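(* Let $N,M\ge 1$ be integers. Let $(P_n)_{n\ge 0}$ and $(Q_n)_{n\ge 0}$ be two monic orthogonal polynomial sequences with respect to the regular linear functionals $\mathbf{u}$ and $\mathbf{v}$, respectively, normalized by $\langle \mathbf{u},1\rangle=1=\langle \mathbf{v},1\rangle$. Assume that they are related by $$P_n(x)+\sum_{i=1}^N r_{i,n}P_{n-i}(x)=Q_n(x)+\sum_{i=1}^M s_{i,n}Q_{n-i}(x),\qquad n\ge 0,$$ where $r_{i,n}, s_{i,n}$ are complex numbers. Let $\mathbf{A}$ be the $(M+N)\times(M+N)$ matrix built from these coefficients as defined in the context. Then the following statements are equivalent: (a) $\det \mathbf{A}\neq 0$, $r_{N,N+M}\neq 0$ and $s_{M,N+M}\neq 0$. (b) There exist polynomials $\Phi_M$ and $\Psi_N$ of (exact) degrees $M$ and $N$, respectively, such that $\Phi_M\,\mathbf{u}=\Psi_N\,\mathbf{v}$, and there is no other relationship $\widetilde{\Phi}_M\,\mathbf{u}=\widetilde{\Psi}_N\,\mathbf{v}$ with polynomials $\widetilde\Phi_M,\widetilde\Psi_N$ of degrees less than or equal to $M$ and $N$, respectively; that is, any pair of polynomials $(\widetilde\Phi_M,\widetilde\Psi_N)$ with $\deg\widetilde\Phi_M\le M$, $\deg\widetilde\Psi_N\le N$ and $\widetilde{\Phi}_M\,\mathbf{u}=\widetilde{\Psi}_N\,\mathbf{v}$ is a constant multiple of $(\Phi_M,\Psi_N)$.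
   Context: All polynomials have complex coefficients, and linear functionals are complex linear functionals on the space of polynomials. For a functional $\mathbf{u}$ and polynomials $\phi,p$, the functional $\phi\mathbf{u}$ is defined by $\langle \phi\mathbf{u},p\rangle=\langle \mathbf{u},\phi p\rangle$. A monic orthogonal polynomial sequence (MOPS) with respect to $\mathbf{u}$ is a sequence of monic polynomials $P_n$ with $\deg P_n=n$, $\langle \mathbf{u},P_nP_m\rangle=0$ for $n\ne m$ and $\langle \mathbf{u},P_n^2\rangle\neq 0$ for all $n$; $\mathbf{u}$ is regular if such a sequence exists. Polynomials with negative index are zero. Put $R_n:=P_n+\sum_{i=1}^N r_{i,n}P_{n-i}=Q_n+\sum_{i=1}^M s_{i,n}Q_{n-i}$. The dual basis of a sequence $(S_n)_n$ of polynomials with $\deg S_n=n$ is the sequence of functionals $(\mathbf{d}_n)_n$ with $\langle \mathbf{d}_n,S_j\rangle=\delta_{n,j}$. Let $(\mathbf{c}_n)_n,(\mathbf{a}_n)_n,(\mathbf{b}_n)_n$ be the dual bases of $(R_n)_n,(P_n)_n,(Q_n)_n$. The matrix $\mathbf{A}$ is defined by expanding $$\mathbf{A}(\mathbf{c}_0,\dots,\mathbf{c}_{M+N-1})^T=(\mathbf{a}_0,\dots,\mathbf{a}_{M-1},\mathbf{b}_0,\dots,\mathbf{b}_{N-1})^T.$$ Explicitly, numbering rows and columns from $0$ to $M+N-1$ and putting $r_{0,j}=s_{0,j}=1$: for $0\le i\le M-1$ the $(i,j)$ entry is $\langle \mathbf{a}_i,R_j\rangle = r_{j-i,j}$ if $i\le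 j\le i+N$ and $0$ otherwise; for $0\le k\le N-1$ the $(M+k,j)$ entry is $\langle \mathbf{b}_k,R_j\rangle=s_{j-k,j}$ if $k\le j\le k+M$ and $0$ otherwise. *)

theory Defs
  imports Complex_Main "HOL-Computational_Algebra.Polynomial" "Jordan_Normal_Form.Determinant"
begin

definition linear_functional :: "(complex poly \<Rightarrow> complex) \<Rightarrow> bool" where
  "linear_functional u \<longleftrightarrow> Vector_Spaces.linear smult (*) u"

definition poly_times :: "complex poly \<Rightarrow> (complex poly \<Rightarrow> complex) \<Rightarrow> complex poly \<Rightarrow> complex" where
  "poly_times \<phi> u = (\<lambda>p. u (\<phi> * p))"

definition mops :: "(complex poly \<Rightarrow> complex) \<Rightarrow> (nat \<Rightarrow> complex poly) \<Rightarrow> bool" where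
  "mops u P \<longleftrightarrow>
     (\<forall>n. degree (P n) = n \<and> lead_coeff (P n) = 1) \<and>
     (\<forall>n m. n \<noteq> m \<longrightarrow> u (P n * P m) = 0) \<and>
     (\<forall>n. u ((P n)^2) \<noteq> 0)"

definition regular :: "(complex poly \<Rightarrow> complex) \<Rightarrow> bool" where
  "regular u \<longleftrightarrow> linear_functional u \<and> (\<exists>P. mops u P)"

text \<open>\<open>lag P n i\<close> is \<open>P\<^sub>n\<^sub>-\<^sub>i\<close>, where polynomials of negative index are zero; a plain
  \<open>P (n - i)\<close> would be wrong for \<open>i > n\<close> because subtraction on naturals truncates.\<close>

definition lag :: "(nat \<Rightarrow> complex poly) \<Rightarrow> nat \<Rightarrow> nat \<Rightarrow> complex poly" where
  "lag P n i = (if i \<le> n then P (n - i) else 0)"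

definition perturb ::
    "nat \<Rightarrow> (nat \<Rightarrow> nat \<Rightarrow> complex) \<Rightarrow> (nat \<Rightarrow> complex poly) \<Rightarrow> nat \<Rightarrow> complex poly" where
  "perturb N r P n = P n + (\<Sum>i=1..N. smult (r i n) (lag P n i))"

text \<open>\<open>band N r i j\<close> is \<open>r\<^sub>j\<^sub>-\<^sub>i\<^sub>,\<^sub>j\<close> on the band \<open>i \<le> j \<le> i + N\<close>, with the convention
  \<open>r\<^sub>0\<^sub>,\<^sub>j = 1\<close> irrespective of the value of \<open>r 0 j\<close>.\<close>

definition band :: "nat \<Rightarrow> (nat \<Rightarrow> nat \<Rightarrow> complex) \<Rightarrow> nat \<Rightarrow> nat \<Rightarrow> complex" where
  "band N r i j =
     (if i \<le> j \<and> j \<le> i + N then (if j = i then 1 else r (j - i) j) else 0)"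

definition conn_mat ::
    "nat \<Rightarrow> nat \<Rightarrow> (nat \<Rightarrow> nat \<Rightarrow> complex) \<Rightarrow> (nat \<Rightarrow> nat \<Rightarrow> complex) \<Rightarrow> complex mat" where
  "conn_mat M N r s =
     mat (M + N) (M + N) (\<lambda>(i, j). if i < M then band N r i j else band M s (i - M) j)"

definition dual_basis ::
    "(nat \<Rightarrow> complex poly) \<Rightarrow> (nat \<Rightarrow> complex poly \<Rightarrow> complex) \<Rightarrow> bool" where
  "dual_basis S d \<longleftrightarrow>
     (\<forall>n. linear_functional (d n) \<and> (\<forall>j. d n (S j) = (if n = j then 1 else 0)))"

text \<open>The remaining lemmas check that the explicit matrix \<open>conn_mat\<close> is the one that expands
  the initial dual functionals of \<open>P\<close> and \<open>Q\<close> in those of the common sequence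
  \<open>perturb N r P = perturb M s Q\<close>.\<close>

lemma linear_functional_simps:
  assumes "linear_functional u"
  shows "u (p + q) = u p + u q" "u (smult c p) = c * u p" "u 0 = 0"
    "u (\<Sum>x\<in>X. f x) = (\<Sum>x\<in>X. u (f x))"
proof -
  interpret Vector_Spaces.linear smult "(*)" u
    using assms by (simp add: linear_functional_def)
  show "u (p + q) = u p + u q" "u (smult c p) = c * u p" "u 0 = 0"
    "u (\<Sum>x\<in>X. f x) = (\<Sum>x\<in>X. u (f x))"
    by (simp_all add: add scale zero sum)
qed

lemma dual_basis_perturb:
  assumes "dual_basis P a"
  shows "a i (perturb N r P j) = band N r i j"
proof -
  have lin: "linear_functional (a i)" and d: "\<And>k. a i (P k) = (if i = k then 1 else 0)"
    using assms by (auto simp: dual_basis_def)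
  have "a i (perturb N r P j) =
      (if i = j then 1 else 0) + (\<Sum>k=1..N. r k j * a i (lag P j k))"
    by (simp add: perturb_def linear_functional_simps[OF lin] d)
  also have "(\<Sum>k=1..N. r k j * a i (lag P j k)) =
      (\<Sum>k=1..N. if k = j - i then (if i < j then r k j else 0) else 0)"
    by (rule sum.cong) (auto simp: lag_def d linear_functional_simps[OF lin])
  also have "\<dots> = (if i < j \<and> j \<le> i + N then r (j - i) j else 0)"
    by (subst sum.delta) auto
  finally show ?thesis by (auto simp: band_def)
qed

lemma monic_seq_functional_eqI:
  assumes f: "linear_functional f" and g: "linear_functional g"
    and R: "\<And>n. degree (R n) = n \<and> lead_coeff (R n) = 1"
    and eq: "\<And>n. f (R n) = g (R n)"
  shows "f p = g p"
proof (induction "degree p" arbitrary: p rule: less_induct)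
  case less
  have R1: "coeff (R n) n = 1" for n using R[of n] by metis
  let ?n = "degree p"
  let ?q = "p + smult (- lead_coeff p) (R ?n)"
  have p: "p = ?q + smult (lead_coeff p) (R ?n)" by simp
  have "f ?q = g ?q"
  proof (cases "?n = 0")
    case True
    have "degree ?q \<le> 0" using R[of ?n] True
      by (intro degree_add_le) auto
    moreover have "coeff ?q 0 = 0" using R1[of 0] True by simp
    ultimately have "?q = 0" by (metis degree_0_id le_zero_eq pCons_0_0)
    then show ?thesis by (simp add: linear_functional_simps[OF f] linear_functional_simps[OF g])
  next
    case False
    have "degree ?q \<le> ?n"
      using R[of ?n] by (intro degree_add_le) auto
    moreover have "coeff ?q ?n = 0" using R1[of ?n] by simp
    ultimately have "degree ?q < ?n" using False
      by (metis leading_coeff_0_iff degree_0 le_neq_implies_less)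
    then show ?thesis by (rule less)
  qed
  then show "f p = g p"
    by (subst (1 2) p) (simp only: linear_functional_simps[OF f] linear_functional_simps[OF g] eq)
qed

lemma perturb_monic:
  assumes P: "\<And>n. degree (P n) = n \<and> lead_coeff (P n) = 1"
  shows "degree (perturb N r P n) = n \<and> lead_coeff (perturb N r P n) = 1"
proof -
  let ?S = "\<Sum>i=1..N. smult (r i n) (lag P n i)"
  have c: "coeff ?S m = 0" if "m \<ge> n" for m
    using that P unfolding coeff_sum
    by (intro sum.neutral) (auto simp: lag_def intro!: coeff_eq_0)
  have "coeff (P n) n = 1" using P[of n] by metis
  then have "coeff (perturb N r P n) n = 1" using c[of n] by (simp add: perturb_def)
  moreover have "degree (perturb N r P n) \<le> n"
    using c P[of n] by (intro degree_le) (auto simp: perturb_def intro!: coeff_eq_0)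
  ultimately show ?thesis by (metis le_degree le_antisym zero_neq_one)
qed

lemma conn_mat_expands:
  assumes P: "\<And>n. degree (P n) = n \<and> lead_coeff (P n) = 1"
    and rel: "\<And>n. perturb N r P n = perturb M s Q n"
    and a: "dual_basis P a" and b: "dual_basis Q b" and c: "dual_basis (perturb N r P) c"
    and i: "i < M + N"
  shows "(if i < M then a i p else b (i - M) p) = (\<Sum>j<M + N. conn_mat M N r s $$ (i, j) * c j p)"
proof -
  let ?f = "\<lambda>p. if i < M then a i p else b (i - M) p"
  let ?g = "\<lambda>p. \<Sum>j<M + N. conn_mat M N r s $$ (i, j) * c j p"
  have vs: "vector_space (smult :: complex \<Rightarrow> complex poly \<Rightarrow> complex poly)"
    "vector_space ((*) :: complex \<Rightarrow> complex \<Rightarrow> complex)"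
    by (unfold_locales; simp add: algebra_simps smult_add_left smult_add_right)+
  have linI: "linear_functional h"
    if "\<And>p q. h (p + q) = h p + h q" "\<And>k p. h (smult k p) = k * h p" for h
    using vs that unfolding linear_functional_def Vector_Spaces.linear_def
      module_hom_def module_hom_axioms_def
    by (auto simp: module_iff_vector_space)
  have la: "linear_functional (a n)" "linear_functional (b n)" "linear_functional (c n)" for n
    using a b c by (auto simp: dual_basis_def)
  note ls = la[THEN linear_functional_simps(1)] la[THEN linear_functional_simps(2)]
  have f: "linear_functional ?f" by (rule linI) (simp_all add: ls)
  have g: "linear_functional ?g"
    by (rule linI) (simp_all add: ls algebra_simps sum.distrib sum_distrib_left)
  have "?f (perturb N r P n) = ?g (perturb N r P n)" for n
  proof -
    have cn: "c j (perturb N r P n) = (if j = n then 1 else 0)" for j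
      using c by (simp add: dual_basis_def)
    have "?g (perturb N r P n) = (if n < M + N then conn_mat M N r s $$ (i, n) else 0)"
      by (simp add: cn if_distrib[where f = "\<lambda>x. _ * x"] cong: if_cong)
    also have "\<dots> = (if i < M then band N r i n else band M s (i - M) n)"
      using i by (auto simp: conn_mat_def band_def)
    also have "\<dots> = ?f (perturb N r P n)"
      using dual_basis_perturb[OF a, of i N r n] dual_basis_perturb[OF b, of "i - M" M s n]
      by (simp add: rel[of n])
    finally show ?thesis by simp
  qed
  then show ?thesis by (rule monic_seq_functional_eqI[OF f g perturb_monic[OF P]])
qed

end

theory Submission
  imports Defs
begin

text \<open>Dividing the \<open>P\<^sub>i\<close> by \<open>\<langle>u, P\<^sub>i\<^sup>2\<rangle>\<close> turns \<open>\<Phi> u\<close> with \<open>deg \<Phi> \<le> M\<close> into a combination of the dual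
  functionals \<open>a\<^sub>0, \<dots>, a\<^sub>M\<close>; similarly \<open>\<Psi> v\<close> is a combination of \<open>b\<^sub>0, \<dots>, b\<^sub>N\<close>.  Evaluated at the
  common sequence \<open>R\<^sub>j\<close>, the equation \<open>\<Phi> u = \<Psi> v\<close> becomes \<open>M + N + 1\<close> linear equations in \<open>M + N + 2\<close>
  unknowns.  In the last equation only the two leading coefficients occur, with coefficients
  \<open>r\<^sub>N\<^sub>,\<^sub>N\<^sub>+\<^sub>M\<close> and \<open>s\<^sub>M\<^sub>,\<^sub>N\<^sub>+\<^sub>M\<close>, and the others determine the remaining unknowns through the transpose of
  \<open>A\<close>.  So the solution space is a line with both leading coefficients nonzero exactly under (a).\<close>

section \<open>Square linear systems bordered by one further equation\<close>

lemma solve_square_system: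
  fixes A :: "'a :: field mat"
  assumes A: "A \<in> carrier_mat n n" and "det A \<noteq> 0" and b: "b \<in> carrier_vec n"
  obtains x where "x \<in> carrier_vec n" "A *\<^sub>v x = b"
proof -
  obtain B where B: "B \<in> carrier_mat n n" "A * B = 1\<^sub>m n"
    using det_non_zero_imp_unit[OF A \<open>det A \<noteq> 0\<close>, of "()"]
    by (auto simp: Units_def ring_mat_def)
  then have "A *\<^sub>v (B *\<^sub>v b) = b"
    using A b by (metis assoc_mult_mat_vec one_mult_mat_vec)
  then show thesis using that B b by (metis mult_mat_vec_carrier)
qed

text \<open>\<open>f i j\<close> and \<open>g k j\<close> stand for the values at \<open>R_j\<close>
  of the dual functionals \<open>a_i\<close> and \<open>b_k\<close>. The vanishing assumptions leave
  only \<open>\<alpha> M\<close> and \<open>\<beta> N\<close> in equation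
  \<open>j = M + N\<close>.\<close>

locale bordered_system =
  fixes M N :: nat and f g :: "nat \<Rightarrow> nat \<Rightarrow> 'a :: field"
  assumes f_last: "i < M \<Longrightarrow> f i (M + N) = 0"
    and g_last: "k < N \<Longrightarrow> g k (M + N) = 0"
begin

definition core :: "'a mat" where
  "core = mat (M + N) (M + N) (\<lambda>(i, j). if i < M then f i j else g (i - M) j)"

definition solution :: "(nat \<Rightarrow> 'a) \<Rightarrow> (nat \<Rightarrow> 'a) \<Rightarrow> bool" where
  "solution \<alpha> \<beta> \<longleftrightarrow> (\<forall>j\<le>M + N. (\<Sum>i\<le>M. \<alpha> i * f i j) = (\<Sum>k\<le>N. \<beta> k * g k j))"

text \<open>The minus sign brings both sums to one side. The leading unknowns
  \<open>\<alpha> M\<close> and \<open>\<beta> N\<close> are left out because they form the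
  right-hand side of the square system.\<close>

definition stack :: "(nat \<Rightarrow> 'a) \<Rightarrow> (nat \<Rightarrow> 'a) \<Rightarrow> 'a vec" where
  "stack \<alpha> \<beta> = vec (M + N) (\<lambda>i. if i < M then \<alpha> i else - \<beta> (i - M))"

lemma core_carrier: "transpose_mat core \<in> carrier_mat (M + N) (M + N)"
  by (simp add: core_def)

lemma det_core: "det (transpose_mat core) = det core"
  by (rule det_transpose[where n = "M + N"]) (simp add: core_def)

lemma stack_carrier: "stack \<alpha> \<beta> \<in> carrier_vec (M + N)"
  by (simp add: stack_def)

lemma core_mult_stack:
  assumes "j < M + N"
  shows "(transpose_mat core *\<^sub>v stack \<alpha> \<beta>) $ j = (\<Sum>i<M. \<alpha> i * f i j) - (\<Sum>k<N. \<beta> k * g k j)"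
proof -
  let ?h = "\<lambda>i. core $$ (i, j) * (if i < M then \<alpha> i else - \<beta> (i - M))"
  have "(transpose_mat core *\<^sub>v stack \<alpha> \<beta>) $ j = (\<Sum>i = 0..<M + N. ?h i)"
    using assms by (simp add: core_def stack_def scalar_prod_def)
  also have "\<dots> = (\<Sum>i = 0..<M. ?h i) + (\<Sum>i = 0 + M..<N + M. ?h i)"
    using sum.atLeastLessThan_concat[of 0 M "M + N" ?h] by (simp add: add.commute)
  also have "(\<Sum>i = 0 + M..<N + M. ?h i) = (\<Sum>k = 0..<N. ?h (k + M))"
    by (rule sum.shift_bounds_nat_ivl)
  finally show ?thesis
    using assms by (simp add: core_def lessThan_atLeast0 sum_negf mult.commute)
qed

text \<open>In equation \<open>j = M + N\<close> only the two leading terms survive. In each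
  equation \<open>j < M + N\<close>, moving them to the right leaves the transposed core applied to
  the stacked unknowns.\<close>

lemma solution_iff:
  "solution \<alpha> \<beta> \<longleftrightarrow> \<alpha> M * f M (M + N) = \<beta> N * g N (M + N) \<and>
     transpose_mat core *\<^sub>v stack \<alpha> \<beta> = vec (M + N) (\<lambda>j. \<beta> N * g N j - \<alpha> M * f M j)"
proof -
  let ?E = "\<lambda>j. (\<Sum>i\<le>M. \<alpha> i * f i j) = (\<Sum>k\<le>N. \<beta> k * g k j)"
  have "?E (M + N) \<longleftrightarrow> \<alpha> M * f M (M + N) = \<beta> N * g N (M + N)"
    by (simp add: f_last g_last flip: lessThan_Suc_atMost)
  moreover have "?E j \<longleftrightarrow> (transpose_mat core *\<^sub>v stack \<alpha> \<beta>) $ j = \<beta> N * g N j - \<alpha> M * f M j"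
    if "j < M + N" for j
    by (auto simp add: core_mult_stack[OF that] algebra_simps simp flip: lessThan_Suc_atMost)
  moreover have "solution \<alpha> \<beta> \<longleftrightarrow> ?E (M + N) \<and> (\<forall>j<M + N. ?E j)"
    unfolding solution_def using le_less by blast
  ultimately show ?thesis
    using core_carrier by (auto simp: vec_eq_iff)
qed

text \<open>\<open>stack\<close> reads neither \<open>\<alpha> M\<close> nor
  \<open>\<beta> N\<close>, so these two values can be prescribed freely.\<close>

lemma obtain_stack:
  assumes "w \<in> carrier_vec (M + N)"
  obtains \<alpha> \<beta> where "stack \<alpha> \<beta> = w" "\<alpha> M = x" "\<beta> N = y"
proof
  let ?\<alpha> = "\<lambda>i. if i < M then w $ i else x" and ?\<beta> = "\<lambda>k. if k < N then - w $ (k + M) else y"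
  show "stack ?\<alpha> ?\<beta> = w" using assms by (intro eq_vecI) (auto simp: stack_def)
  show "?\<alpha> M = x" "?\<beta> N = y" by simp_all
qed

lemma stack_eq_0D:
  assumes "stack \<alpha> \<beta> = 0\<^sub>v (M + N)"
  shows "i < M \<Longrightarrow> \<alpha> i = 0" and "k < N \<Longrightarrow> \<beta> k = 0"
proof -
  have *: "stack \<alpha> \<beta> $ m = 0" if "m < M + N" for m using assms that by simp
  show "\<alpha> i = 0" if "i < M" using *[of i] that by (simp add: stack_def)
  show "\<beta> k = 0" if "k < N" using *[of "M + k"] that by (simp add: stack_def)
qed

text \<open>The condition on \<open>x\<close> and \<open>y\<close> is the last equation;
  invertibility of the core then yields the remaining unknowns.\<close>

lemma solution_exists:
  assumes "det core \<noteq> 0" and "x * f M (M + N) = y * g N (M + N)"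
  obtains \<alpha> \<beta> where "solution \<alpha> \<beta>" "\<alpha> M = x" "\<beta> N = y"
proof -
  obtain w where w: "w \<in> carrier_vec (M + N)"
    "transpose_mat core *\<^sub>v w = vec (M + N) (\<lambda>j. y * g N j - x * f M j)"
    using solve_square_system[OF core_carrier] assms(1) det_core by (metis vec_carrier)
  obtain \<alpha> \<beta> where "stack \<alpha> \<beta> = w" "\<alpha> M = x" "\<beta> N = y" by (rule obtain_stack[OF w(1)])
  with w(2) assms(2) show thesis by (intro that[of \<alpha> \<beta>]) (simp_all add: solution_iff)
qed

text \<open>Zero leading values make the right-hand side of the square system vanish, so the stacked
  unknowns lie in the kernel of an invertible matrix.\<close>

lemma solution_eq_0:
  assumes "det core \<noteq> 0" "solution \<alpha> \<beta>" "\<alpha> M = 0" "\<beta> N = 0"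
  shows "i \<le> M \<Longrightarrow> \<alpha> i = 0" and "k \<le> N \<Longrightarrow> \<beta> k = 0"
proof -
  have "transpose_mat core *\<^sub>v stack \<alpha> \<beta> = 0\<^sub>v (M + N)"
    using assms by (auto simp: solution_iff)
  then have "stack \<alpha> \<beta> = 0\<^sub>v (M + N)"
    using det_0_iff_vec_prod_zero[OF core_carrier] assms(1) det_core stack_carrier by metis
  then show "i \<le> M \<Longrightarrow> \<alpha> i = 0" "k \<le> N \<Longrightarrow> \<beta> k = 0"
    using stack_eq_0D assms by (metis le_less)+
qed

lemma solution_diff:
  assumes "solution \<alpha> \<beta>" "solution \<alpha>' \<beta>'"
  shows "solution (\<lambda>i. \<alpha>' i - c * \<alpha> i) (\<lambda>k. \<beta>' k - c * \<beta> k)"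
  using assms unfolding solution_def
  by (simp add: algebra_simps sum_subtractf flip: sum_distrib_left)

theorem solution_line_iff:
  "det core \<noteq> 0 \<and> f M (M + N) \<noteq> 0 \<and> g N (M + N) \<noteq> 0 \<longleftrightarrow>
   (\<exists>\<alpha> \<beta>. \<alpha> M \<noteq> 0 \<and> \<beta> N \<noteq> 0 \<and> solution \<alpha> \<beta> \<and>
      (\<forall>\<alpha>' \<beta>'. solution \<alpha>' \<beta>' \<longrightarrow>
         (\<exists>c. (\<forall>i\<le>M. \<alpha>' i = c * \<alpha> i) \<and> (\<forall>k\<le>N. \<beta>' k = c * \<beta> k))))"
  (is "?L \<longleftrightarrow> ?R")
proof
  assume L: ?L
  \<comment> \<open>The crosswise choice of leading values satisfies the last equation, and both are
    nonzero.\<close>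
  then obtain \<alpha> \<beta> where sol: "solution \<alpha> \<beta>" and lead: "\<alpha> M = g N (M + N)" "\<beta> N = f M (M + N)"
    using solution_exists[of "g N (M + N)" "f M (M + N)"] by (metis mult.commute)
  have "\<exists>c. (\<forall>i\<le>M. \<alpha>' i = c * \<alpha> i) \<and> (\<forall>k\<le>N. \<beta>' k = c * \<beta> k)" if sol': "solution \<alpha>' \<beta>'" for \<alpha>' \<beta>'
  proof -
    \<comment> \<open>This \<open>c\<close> matches the leading value of \<open>\<alpha>'\<close>;
      by the last equation it matches that of \<open>\<beta>'\<close> too, so the difference has
      zero leading values.\<close>
    define c where "c = \<alpha>' M / \<alpha> M"
    have "\<alpha>' M * f M (M + N) = \<beta>' N * g N (M + N)" using sol' by (simp add: solution_iff)
    then have "\<alpha>' M - c * \<alpha> M = 0" "\<beta>' N - c * \<beta> N = 0"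
      using L lead by (simp_all add: c_def field_simps)
    from solution_eq_0[OF _ solution_diff[OF sol sol'] this] L
    have "\<forall>i\<le>M. \<alpha>' i = c * \<alpha> i" "\<forall>k\<le>N. \<beta>' k = c * \<beta> k" by auto
    then show ?thesis by blast
  qed
  with sol lead L show ?R by metis
next
  assume ?R
  then obtain \<alpha> \<beta> where nz: "\<alpha> M \<noteq> 0" "\<beta> N \<noteq> 0" and sol: "solution \<alpha> \<beta>"
    and line: "\<And>\<alpha>' \<beta>'. solution \<alpha>' \<beta>' \<Longrightarrow>
      \<exists>c. (\<forall>i\<le>M. \<alpha>' i = c * \<alpha> i) \<and> (\<forall>k\<le>N. \<beta>' k = c * \<beta> k)"
    by blast
  have det: "det core \<noteq> 0"
  proof
    assume "det core = 0"
    then obtain w where w: "w \<in> carrier_vec (M + N)" "w \<noteq> 0\<^sub>v (M + N)"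
      "transpose_mat core *\<^sub>v w = 0\<^sub>v (M + N)"
      using det_0_iff_vec_prod_zero[OF core_carrier] det_core by metis
    \<comment> \<open>Completed by zero leading values, the kernel vector gives a solution. It is a
      multiple of \<open>(\<alpha>, \<beta>)\<close>, and \<open>\<alpha> M \<noteq> 0\<close>
      forces the factor to be zero.\<close>
    obtain \<alpha>' \<beta>' where st: "stack \<alpha>' \<beta>' = w" and lead: "\<alpha>' M = 0" "\<beta>' N = 0"
      by (rule obtain_stack[OF w(1)])
    have "solution \<alpha>' \<beta>'" using w(3) st lead by (auto simp: solution_iff)
    then obtain c where c: "\<forall>i\<le>M. \<alpha>' i = c * \<alpha> i" "\<forall>k\<le>N. \<beta>' k = c * \<beta> k"
      using line by blast
    with lead nz have "c = 0" by auto
    with c have "stack \<alpha>' \<beta>' = 0\<^sub>v (M + N)" by (auto simp: stack_def)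
    with st w show False by simp
  qed
  have eq: "\<alpha> M * f M (M + N) = \<beta> N * g N (M + N)" using sol by (simp add: solution_iff)
  have "f M (M + N) \<noteq> 0"
  proof
    assume "f M (M + N) = 0"
    \<comment> \<open>The leading values \<open>(1, 0)\<close> now satisfy the last equation, but
      since \<open>\<beta> N \<noteq> 0\<close> no multiple of \<open>(\<alpha>, \<beta>)\<close>
      has them.\<close>
    then obtain \<alpha>' \<beta>' where "solution \<alpha>' \<beta>'" "\<alpha>' M = 1" "\<beta>' N = 0"
      using solution_exists[OF det, of 1 0] by auto
    with line nz show False by (metis le_refl mult_eq_0_iff zero_neq_one)
  qed
  moreover from this eq nz have "g N (M + N) \<noteq> 0" by auto
  ultimately show ?L using det by blast
qed

end

section \<open>Expansions in polynomial sequences with one member of each degree\<close>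

lemma graded_coeff_sum:
  fixes e :: "nat \<Rightarrow> 'a :: comm_semiring_0 poly"
  assumes "\<And>i. degree (e i) = i"
  shows "coeff (\<Sum>i\<le>n. smult (\<alpha> i) (e i)) n = \<alpha> n * lead_coeff (e n)"
proof -
  have "coeff (e i) n = 0" if "i < n" for i using that assms by (simp add: coeff_eq_0)
  then show ?thesis using assms by (simp add: coeff_sum flip: lessThan_Suc_atMost)
qed

lemma graded_degree_sum:
  fixes e :: "nat \<Rightarrow> 'a :: comm_semiring_0 poly"
  assumes "\<And>i. degree (e i) = i"
  shows "degree (\<Sum>i\<le>n. smult (\<alpha> i) (e i)) \<le> n"
  using assms by (intro degree_sum_le) (auto intro: order_trans[OF degree_smult_le])

lemma graded_span:
  fixes e :: "nat \<Rightarrow> 'a :: field poly"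
  assumes deg: "\<And>i. degree (e i) = i" and nz: "\<And>i. e i \<noteq> 0" and "degree p \<le> n"
  obtains \<alpha> where "p = (\<Sum>i\<le>n. smult (\<alpha> i) (e i))"
proof -
  have "\<exists>\<alpha>. p = (\<Sum>i\<le>n. smult (\<alpha> i) (e i))" using \<open>degree p \<le> n\<close>
  proof (induction n arbitrary: p)
    case 0
    obtain a b where ab: "p = [:a:]" "e 0 = [:b:]" using 0 deg[of 0] by (metis degree_eq_zeroE le_zero_eq)
    then have "b \<noteq> 0" using nz[of 0] by auto
    with ab show ?case by (intro exI[of _ "\<lambda>_. a / b"]) simp
  next
    case (Suc n)
    define c where "c = coeff p (Suc n) / lead_coeff (e (Suc n))"
    define q where "q = p - smult c (e (Suc n))"
    have "coeff (e (Suc n)) (Suc n) \<noteq> 0" using nz deg by (metis leading_coeff_0_iff)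
    then have "coeff q (Suc n) = 0" by (simp add: q_def c_def deg)
    moreover have "degree q \<le> Suc n"
      unfolding q_def using Suc.prems deg
      by (intro degree_diff_le) (auto intro: order_trans[OF degree_smult_le])
    ultimately have "degree q \<le> n"
      by (metis coeff_0_degree_minus_1 diff_Suc_1 le_SucE leading_coeff_0_iff degree_0 zero_le)
    then obtain \<alpha> where \<alpha>: "q = (\<Sum>i\<le>n. smult (\<alpha> i) (e i))" using Suc.IH by blast
    have "p = q + smult c (e (Suc n))" by (simp add: q_def)
    then have "p = (\<Sum>i\<le>Suc n. smult ((\<alpha>(Suc n := c)) i) (e i))" using \<alpha> by simp
    then show ?case by blast
  qed
  then show thesis using that by blast
qed

text \<open>Only the last term contributes to the top coefficient, so the last scalars agree and
  cancel; induction treats the others.\<close>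

lemma graded_independent:
  fixes e :: "nat \<Rightarrow> 'a :: field poly"
  assumes deg: "\<And>i. degree (e i) = i" and nz: "\<And>i. e i \<noteq> 0"
    and eq: "(\<Sum>i\<le>n. smult (\<alpha> i) (e i)) = (\<Sum>i\<le>n. smult (\<beta> i) (e i))" and "i \<le> n"
  shows "\<alpha> i = \<beta> i"
  using eq \<open>i \<le> n\<close>
proof (induction n)
  case 0
  then have "smult (\<alpha> 0 - \<beta> 0) (e 0) = 0" by (simp add: smult_diff_left)
  with 0 nz[of 0] show ?case by simp
next
  case (Suc n)
  have "\<alpha> (Suc n) = \<beta> (Suc n)"
    using arg_cong[OF Suc.prems(1), of "\<lambda>p. coeff p (Suc n)"] nz[of "Suc n"]
    by (subst (asm) (1 2) graded_coeff_sum[OF deg]) simp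
  with Suc show ?case by (cases "i = Suc n") auto
qed

section \<open>Dual functionals as polynomial multiples of \<open>u\<close> and
  \<open>v\<close>\<close>

lemma poly_times_linear:
  assumes "linear_functional u"
  shows "linear_functional (poly_times \<phi> u)"
proof -
  interpret Vector_Spaces.linear smult "(*)" u using assms by (simp add: linear_functional_def)
  show ?thesis
    unfolding linear_functional_def poly_times_def
    by unfold_locales (simp_all add: add scale algebra_simps)
qed

text \<open>Normalized so that, by orthogonality, \<open>poly_times (dual_poly u P n) u\<close> is
  the \<open>n\<close>-th dual functional of \<open>P\<close>.\<close>

definition dual_poly :: "(complex poly \<Rightarrow> complex) \<Rightarrow> (nat \<Rightarrow> complex poly) \<Rightarrow> nat \<Rightarrow> complex poly" where
  "dual_poly u P n = smult (1 / u ((P n)\<^sup>2)) (P n)"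

lemma
  assumes "mops u P"
  shows degree_dual_poly: "degree (dual_poly u P n) = n"
    and dual_poly_nz: "dual_poly u P n \<noteq> 0"
proof -
  have "u ((P n)\<^sup>2) \<noteq> 0" "degree (P n) = n" "lead_coeff (P n) = 1"
    using assms unfolding mops_def by blast+
  then show "degree (dual_poly u P n) = n" "dual_poly u P n \<noteq> 0" by (auto simp: dual_poly_def)
qed

lemma dual_basis_dual_poly:
  assumes "linear_functional u" "mops u P"
  shows "dual_basis P (\<lambda>n. poly_times (dual_poly u P n) u)"
  unfolding dual_basis_def
proof (intro allI conjI)
  fix n j
  show "linear_functional (poly_times (dual_poly u P n) u)"
    by (rule poly_times_linear[OF assms(1)])
  have "u (P n * P n) \<noteq> 0" "n \<noteq> j \<Longrightarrow> u (P n * P j) = 0"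
    using assms(2) by (auto simp: mops_def power2_eq_square)
  then show "poly_times (dual_poly u P n) u (P j) = (if n = j then 1 else 0)"
    by (auto simp: poly_times_def dual_poly_def linear_functional_simps[OF assms(1)] power2_eq_square)
qed

lemma poly_times_dual_poly_perturb:
  assumes u: "linear_functional u" and P: "mops u P"
  shows "poly_times (\<Sum>i\<le>n. smult (\<alpha> i) (dual_poly u P i)) u (perturb N r P j)
    = (\<Sum>i\<le>n. \<alpha> i * band N r i j)"
  using dual_basis_perturb[OF dual_basis_dual_poly[OF u P], of _ N r j]
  by (simp add: poly_times_def sum_distrib_right linear_functional_simps[OF u])

text \<open>A linear functional is determined by its values on the common monic sequence
  \<open>perturb N r P = perturb M s Q\<close>, and on it both sides are sums of band
  entries.\<close>

lemma poly_times_eq_iff: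
  assumes u: "linear_functional u" and v: "linear_functional v"
    and P: "mops u P" and Q: "mops v Q"
    and rel: "\<And>n. perturb N r P n = perturb M s Q n"
  shows "poly_times (\<Sum>i\<le>M. smult (\<alpha> i) (dual_poly u P i)) u
       = poly_times (\<Sum>k\<le>N. smult (\<beta> k) (dual_poly v Q k)) v
    \<longleftrightarrow> (\<forall>j\<le>M + N. (\<Sum>i\<le>M. \<alpha> i * band N r i j) = (\<Sum>k\<le>N. \<beta> k * band M s k j))"
  (is "?f = ?g \<longleftrightarrow> ?E")
proof
  have f: "?f (perturb N r P j) = (\<Sum>i\<le>M. \<alpha> i * band N r i j)" for j
    by (rule poly_times_dual_poly_perturb[OF u P])
  have g: "?g (perturb N r P j) = (\<Sum>k\<le>N. \<beta> k * band M s k j)" for j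
    unfolding rel by (rule poly_times_dual_poly_perturb[OF v Q])
  show ?E if "?f = ?g" using that f g by metis
  assume E: ?E
  have "?f (perturb N r P j) = ?g (perturb N r P j)" for j
  proof (cases "j \<le> M + N")
    case False
    \<comment> \<open>For \<open>j > M + N\<close>, \<open>i \<le> M\<close> gives
      \<open>j > i + N\<close> and \<open>k \<le> N\<close> gives \<open>j > k + M\<close>: all band
      entries vanish.\<close>
    then show ?thesis unfolding f g by (auto simp: band_def intro!: sum.neutral)
  qed (use E f g in metis)
  moreover have "degree (perturb N r P n) = n \<and> lead_coeff (perturb N r P n) = 1" for n
    using P unfolding mops_def by (intro perturb_monic) blast
  ultimately show "?f = ?g"
    using monic_seq_functional_eqI[OF poly_times_linear[OF u] poly_times_linear[OF v]] by blast
qed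

text \<open>The dual polynomials are bases of the polynomials of degree at most \<open>M\<close> and
  \<open>N\<close>. In these coordinates (b) becomes the right-hand side of
  \<open>solution_line_iff\<close>.\<close>

theorem theorem2p2:
  fixes N M :: nat
    and P Q :: "nat \<Rightarrow> complex poly"
    and u v :: "complex poly \<Rightarrow> complex"
    and r s :: "nat \<Rightarrow> nat \<Rightarrow> complex"
  assumes "N \<ge> 1" and "M \<ge> 1"
    and "regular u" and "regular v"
    and "mops u P" and "mops v Q"
    and "u 1 = 1" and "v 1 = 1"
    and "\<And>n. P n + (\<Sum>i=1..N. smult (r i n) (lag P n i))
              = Q n + (\<Sum>i=1..M. smult (s i n) (lag Q n i))"
  shows "(det (conn_mat M N r s) \<noteq> 0 \<and> r N (N + M) \<noteq> 0 \<and> s M (N + M) \<noteq> 0)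
    \<longleftrightarrow>
    (\<exists>\<Phi> \<Psi>. degree \<Phi> = M \<and> degree \<Psi> = N \<and> poly_times \<Phi> u = poly_times \<Psi> v \<and>
       (\<forall>\<Phi>' \<Psi>'. degree \<Phi>' \<le> M \<and> degree \<Psi>' \<le> N \<and> poly_times \<Phi>' u = poly_times \<Psi>' v
          \<longrightarrow> (\<exists>c. \<Phi>' = smult c \<Phi> \<and> \<Psi>' = smult c \<Psi>)))"
proof -
  interpret bordered_system M N "band N r" "band M s"
    by unfold_locales (auto simp: band_def)
  define a where "a \<alpha> = (\<Sum>i\<le>M. smult (\<alpha> i) (dual_poly u P i))" for \<alpha>
  define b where "b \<beta> = (\<Sum>k\<le>N. smult (\<beta> k) (dual_poly v Q k))" for \<beta>
  have lin: "linear_functional u" "linear_functional v"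
    using assms(3,4) by (simp_all add: regular_def)
  have sol: "poly_times (a \<alpha>) u = poly_times (b \<beta>) v \<longleftrightarrow> solution \<alpha> \<beta>" for \<alpha> \<beta>
    unfolding a_def b_def solution_def
    by (rule poly_times_eq_iff[OF lin assms(5,6)]) (unfold perturb_def, rule assms(9))
  note P = degree_dual_poly[OF assms(5)] dual_poly_nz[OF assms(5)]
  note Q = degree_dual_poly[OF assms(6)] dual_poly_nz[OF assms(6)]
  have deg_le: "degree (a \<alpha>) \<le> M" "degree (b \<alpha>) \<le> N" for \<alpha>
    unfolding a_def b_def using graded_degree_sum P(1) Q(1) by blast+
  \<comment> \<open>The bound \<open>n \<ge> 1\<close> matters because the zero polynomial has
    degree 0.\<close>
  have deg_eq: "degree p = n \<longleftrightarrow> coeff p n \<noteq> 0" if "degree p \<le> n" "n \<ge> 1" for p :: "complex poly" and n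
    using that by (metis le_antisym le_degree leading_coeff_0_iff degree_0 not_one_le_zero)
  have deg: "degree (a \<alpha>) = M \<longleftrightarrow> \<alpha> M \<noteq> 0" "degree (b \<alpha>) = N \<longleftrightarrow> \<alpha> N \<noteq> 0" for \<alpha>
    unfolding deg_eq[OF deg_le(1) assms(2)] deg_eq[OF deg_le(2) assms(1)]
    unfolding a_def b_def graded_coeff_sum[OF P(1)] graded_coeff_sum[OF Q(1)]
    by (simp_all only: mult_eq_0_iff leading_coeff_0_iff P(2) Q(2) simp_thms)
  have smult_a: "a \<alpha>' = smult c (a \<alpha>) \<longleftrightarrow> (\<forall>i\<le>M. \<alpha>' i = c * \<alpha> i)" for \<alpha> \<alpha>' c
  proof -
    \<comment> \<open>Multiplying by the constant polynomial \<open>[:c:]\<close> is scaling by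
      \<open>c\<close>, so distributivity of products moves the scalar into the sum.\<close>
    have "smult c (a \<alpha>) = a (\<lambda>i. c * \<alpha> i)" by (simp add: a_def sum_distrib_left[of "[:c:]", simplified])
    then show ?thesis unfolding a_def
      using graded_independent[OF P, of \<alpha>' M "\<lambda>i. c * \<alpha> i"] by auto
  qed
  have smult_b: "b \<beta>' = smult c (b \<beta>) \<longleftrightarrow> (\<forall>k\<le>N. \<beta>' k = c * \<beta> k)" for \<beta> \<beta>' c
  proof -
    have "smult c (b \<beta>) = b (\<lambda>i. c * \<beta> i)" by (simp add: b_def sum_distrib_left[of "[:c:]", simplified])
    then show ?thesis unfolding b_def
      using graded_independent[OF Q, of \<beta>' N "\<lambda>i. c * \<beta> i"] by auto
  qed
  have span: "degree p \<le> M \<Longrightarrow> \<exists>\<alpha>. p = a \<alpha>" "degree p \<le> N \<Longrightarrow> \<exists>\<beta>. p = b \<beta>" for p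
    unfolding a_def b_def by (metis graded_span[OF P]) (metis graded_span[OF Q])
  have line: "(\<forall>\<Phi>' \<Psi>'. degree \<Phi>' \<le> M \<and> degree \<Psi>' \<le> N \<and> poly_times \<Phi>' u = poly_times \<Psi>' v
        \<longrightarrow> (\<exists>c. \<Phi>' = smult c (a \<alpha>) \<and> \<Psi>' = smult c (b \<beta>))) \<longleftrightarrow>
      (\<forall>\<alpha>' \<beta>'. solution \<alpha>' \<beta>' \<longrightarrow>
        (\<exists>c. (\<forall>i\<le>M. \<alpha>' i = c * \<alpha> i) \<and> (\<forall>k\<le>N. \<beta>' k = c * \<beta> k)))" (is "?L \<longleftrightarrow> ?R") for \<alpha> \<beta>
  proof
    assume ?L
    then show ?R by (metis deg_le sol smult_a smult_b)
  next
    assume R: ?R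
    show ?L
    proof (intro allI impI, elim conjE)
      fix \<Phi>' \<Psi>' assume *: "degree \<Phi>' \<le> M" "degree \<Psi>' \<le> N" "poly_times \<Phi>' u = poly_times \<Psi>' v"
      then obtain \<alpha>' \<beta>' where "\<Phi>' = a \<alpha>'" "\<Psi>' = b \<beta>'" using span by blast
      with * R show "\<exists>c. \<Phi>' = smult c (a \<alpha>) \<and> \<Psi>' = smult c (b \<beta>)"
        by (simp add: sol smult_a smult_b)
    qed
  qed
  let ?b = "\<lambda>\<Phi> \<Psi>. degree \<Phi> = M \<and> degree \<Psi> = N \<and> poly_times \<Phi> u = poly_times \<Psi> v \<and>
       (\<forall>\<Phi>' \<Psi>'. degree \<Phi>' \<le> M \<and> degree \<Psi>' \<le> N \<and> poly_times \<Phi>' u = poly_times \<Psi>' v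
          \<longrightarrow> (\<exists>c. \<Phi>' = smult c \<Phi> \<and> \<Psi>' = smult c \<Psi>))"
  have "(\<exists>\<Phi> \<Psi>. ?b \<Phi> \<Psi>) \<longleftrightarrow> (\<exists>\<alpha> \<beta>. ?b (a \<alpha>) (b \<beta>))"
  proof
    assume "\<exists>\<Phi> \<Psi>. ?b \<Phi> \<Psi>"
    then obtain \<Phi> \<Psi> where *: "?b \<Phi> \<Psi>" by blast
    then obtain \<alpha> \<beta> where "\<Phi> = a \<alpha>" "\<Psi> = b \<beta>" using span by (metis le_refl)
    with * show "\<exists>\<alpha> \<beta>. ?b (a \<alpha>) (b \<beta>)" by blast
  qed blast
  also have "\<dots> \<longleftrightarrow> det core \<noteq> 0 \<and> band N r M (M + N) \<noteq> 0 \<and> band M s N (M + N) \<noteq> 0"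
    unfolding solution_line_iff deg sol line by blast
  \<comment> \<open>Since \<open>N \<ge> 1\<close> and \<open>M \<ge> 1\<close>, the two corner
    entries lie off the diagonal, where \<open>band\<close> would be 1 by convention.\<close>
  also have "\<dots> \<longleftrightarrow> det (conn_mat M N r s) \<noteq> 0 \<and> r N (N + M) \<noteq> 0 \<and> s M (N + M) \<noteq> 0"
    using assms(1,2) by (simp add: core_def conn_mat_def band_def add.commute)
  finally show ?thesis by blast
qed

end
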